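(* Let $(A,L,[\cdot,\cdot],\rho)$ be a Lie-Rinehart superalgebra over a field $\mathbb{K}$ of characteristic zero, let $m=[\cdot,\cdot]\in\mathrm{Der}^1(L,L)$, with symbol map $\rho$, and let $N\ge1$. Let $m_t=\sum_{k=0}^Nt^km_k$ be an $N$-order deformation of $m$, with obstruction cochain \[\theta_N(a,b,c)=\sum_{\substack{i+j=N+1\\ i,j>0}}\Big(m_i(a,m_j(b,c))-m_i(m_j(a,b),c)-(-1)^{|a||b|}m_i(b,m_j(a,c))\Big),\quad a,b,c\in L.\] Then $m_t$ extends to an $(N+1)$-order deformation of $m$ if and only if $\theta_N$ is a 3-coboundary of the deformation complex.
   Context: $|x|\in\mathbb{Z}_2$ denotes the degree of a homogeneous element; identities are for homogeneous elements. A superderivation of $A$ of degree $|D|$ is a homogeneous linear map with $D(ab)=D(a)b+(-1)^{|a||D|}aD(b)$; $\mathrm{Der}(A)$ is the Lie superalgebra of superderivations with the supercommutator. A Lie-Rinehart superalgebra $(A,L,[\cdot,\cdot],\rho)$ over $\mathbb{K}$ consists of an associative supercommutative $\mathbb{K}$-superalgebra $A$, a Lie superalgebra $L$ over $\mathbb{K}$ (even bracket, $[x,y]=-(-1)^{|x||y|}[y,x]$, $[x,[y,z]]=[[x,y],z]+(-1)^{|x||y|}[y,[x,z]]$), an $A$-module structure on $L$ with $|ax|=|a|+|x|$, and an even Lie superalgebra morphism $\rho:L\to\mathrm{Der}(A)$ with $[x,ay]=\rho(x)(a)y+(-1)^{|a||x|}a[x,y]$ and $\rho(ax)(b)=a\rho(x)(b)$.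 For $n\ge 0$, $\mathrm{Der}^n(L,L)$ is the space of $\mathbb{K}$-multilinear maps $f:L^{\times(n+1)}\to L$ for which there exists a map $\sigma_f:L^{\otimes n}\to\mathrm{Der}(A)$ (symbol map) such that: (1) $f(x_1,\dots,x_i,x_{i+1},\dots,x_{n+1})=-(-1)^{|x_i||x_{i+1}|}f(x_1,\dots,x_{i+1},x_i,\dots,x_{n+1})$ for $1\le i\le n$; (2) $f(x_1,\dots,x_n,ax_{n+1})=(-1)^{|a|(|f|+|x_1|+\cdots+|x_n|)}af(x_1,\dots,x_{n+1})+\sigma_f(x_1,\dots,x_n)(a)x_{n+1}$ for all $a\in A$. Here $|f|=j$ means $|f(x_1,\dots,x_{n+1})|-\sum_i|x_i|=j$ mod 2, and $\mathrm{Der}^n=\mathrm{Der}^n_0\oplus\mathrm{Der}^n_1$. For $f\in\mathrm{Der}^p(L,L)$, $g\in\mathrm{Der}^q(L,L)$, set \[(f\circ g)(x_1,\dots,x_{p+q+1})=\sum_{\tau}\varepsilon(\tau,x_1,\dots,x_{p+q+1})\,f\big(g(x_{\tau(1)},\dots,x_{\tau(q+1)}),x_{\tau(q+2)},\dots,x_{\tau(p+q+1)}\big),\] summing over permutations $\tau$ of $\{1,\dots,p+q+1\}$ with $\tau(1)<\cdots<\tau(q+1)$ and $\tau(q+2)<\cdots<\tau(p+q+1)$, where $\varepsilon$ is $\mathrm{sgn}(\tau)$ times the Koszul sign of the permutation of the homogeneous $x_i$. The bracket is $[f,g]=f\circ g-(-1)^{pq}g\circ f$. The deformation complex is $C^n_{def}(L,L)=\mathrm{Der}^{n-1}(L,L)$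 with differential $\delta D=[m,D]$; a 3-coboundary is an element $\delta\varphi$ with $\varphi\in C^2_{def}(L,L)=\mathrm{Der}^1(L,L)$. For $M\ge1$, an $M$-order deformation of $m$ is $m_t=\sum_{k=0}^Mt^km_k$ with $m_0=m$, each $m_k\in\mathrm{Der}^1(L,L)$ even, and $[m_t,m_t]=0$ modulo $t^{M+1}$, i.e. $\sum_{i+j=k}[m_i,m_j]=0$ for $0\le k\le M$. The $N$-order deformation $m_t$ extends to an $(N+1)$-order deformation if there is $m_{N+1}\in\mathrm{Der}^1(L,L)$ such that $m_t+t^{N+1}m_{N+1}$ is an $(N+1)$-order deformation of $m$. *)

theory Defs
  imports Complex_Main "HOL-Library.Z2" "HOL-Combinatorics.Permutations"
begin

definition msign :: "bit \<Rightarrow> 'k::field"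
  where "msign d = (if d = 0 then 1 else - 1)"

locale super_vector_space = vector_space scale
  for scale :: "'k::field \<Rightarrow> 'v::ab_group_add \<Rightarrow> 'v" +
  fixes V :: "bit \<Rightarrow> 'v set"
  assumes subspace_hom: "subspace (V d)"
    and hom_Int: "V 0 \<inter> V 1 = {0}"
    and hom_decomp: "\<exists>u\<in>V 0. \<exists>w\<in>V 1. v = u + w"

definition hcomp :: "(bit \<Rightarrow> 'v::ab_group_add set) \<Rightarrow> bit \<Rightarrow> 'v \<Rightarrow> 'v"
  where "hcomp V d v = (THE u. u \<in> V d \<and> (\<exists>w\<in>V (d + 1). v = u + w))"

definition homogeneous :: "(bit \<Rightarrow> 'v set) \<Rightarrow> bit list \<Rightarrow> 'v list \<Rightarrow> bool"
  where "homogeneous V ds xs \<longleftrightarrow> list_all2 (\<lambda>d x. x \<in> V d) ds xs"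

text \<open>
  Maps of \<open>n\<close> arguments are functions on lists of length \<open>n\<close>. They are required to vanish on
  lists of any other length, so that equality of maps is equality of functions.
\<close>

definition multilinear ::
    "('k::field \<Rightarrow> 'v::ab_group_add \<Rightarrow> 'v) \<Rightarrow> ('k \<Rightarrow> 'w::ab_group_add \<Rightarrow> 'w)
      \<Rightarrow> nat \<Rightarrow> ('v list \<Rightarrow> 'w) \<Rightarrow> bool"
  where "multilinear s1 s2 n f \<longleftrightarrow>
    (\<forall>xs. length xs \<noteq> n \<longrightarrow> f xs = 0) \<and>
    (\<forall>xs i. length xs = n \<and> i < n \<longrightarrow> Vector_Spaces.linear s1 s2 (\<lambda>y. f (xs[i := y])))"

text \<open>
  Formulas with Koszul signs are given on homogeneous arguments \<open>ys\<close> of degrees \<open>ds\<close>, as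
  \<open>F ds ys\<close>; \<open>hom_extend\<close> is the multilinear extension to arbitrary arguments, obtained by
  summing over all choices of homogeneous components.
\<close>

definition hom_extend ::
    "(bit \<Rightarrow> 'v::ab_group_add set) \<Rightarrow> nat \<Rightarrow> (bit list \<Rightarrow> 'v list \<Rightarrow> 'w::ab_group_add)
      \<Rightarrow> 'v list \<Rightarrow> 'w"
  where "hom_extend V n F xs =
    (if length xs = n then \<Sum>ds | length ds = n. F ds (map2 (hcomp V) ds xs) else 0)"

text \<open>
  The associative product of \<open>A\<close> is the multiplication of the type \<open>'a\<close>; no unit is assumed.
\<close>

record ('k, 'a, 'l) lr_data =
  scaleA :: "'k \<Rightarrow> 'a \<Rightarrow> 'a"
  homA :: "bit \<Rightarrow> 'a set"
  scaleL :: "'k \<Rightarrow> 'l \<Rightarrow> 'l"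
  homL :: "bit \<Rightarrow> 'l set"
  act :: "'a \<Rightarrow> 'l \<Rightarrow> 'l"
  brak :: "'l \<Rightarrow> 'l \<Rightarrow> 'l"
  anchor :: "'l \<Rightarrow> 'a \<Rightarrow> 'a"

definition superder_hom ::
    "('k::field \<Rightarrow> 'a::ring \<Rightarrow> 'a) \<Rightarrow> (bit \<Rightarrow> 'a set) \<Rightarrow> bit \<Rightarrow> ('a \<Rightarrow> 'a) set"
  where "superder_hom sA A j = {D. Vector_Spaces.linear sA sA D \<and>
    (\<forall>e. \<forall>a\<in>A e. D a \<in> A (j + e)) \<and>
    (\<forall>e. \<forall>a\<in>A e. \<forall>b. D (a * b) = D a * b + sA (msign (e * j)) (a * D b))}"

definition superder ::
    "('k::field \<Rightarrow> 'a::ring \<Rightarrow> 'a) \<Rightarrow> (bit \<Rightarrow> 'a set) \<Rightarrow> ('a \<Rightarrow> 'a) set"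
  where "superder sA A =
    {\<lambda>a. D0 a + D1 a | D0 D1. D0 \<in> superder_hom sA A 0 \<and> D1 \<in> superder_hom sA A 1}"

locale supercommutative_superalgebra = super_vector_space sA A
  for sA :: "'k::field \<Rightarrow> 'a::ring \<Rightarrow> 'a" and A :: "bit \<Rightarrow> 'a set" +
  assumes scale_mult_left: "sA c a * b = sA c (a * b)"
    and scale_mult_right: "a * sA c b = sA c (a * b)"
    and mult_hom: "a \<in> A d \<Longrightarrow> b \<in> A e \<Longrightarrow> a * b \<in> A (d + e)"
    and supercommute: "a \<in> A d \<Longrightarrow> b \<in> A e \<Longrightarrow> a * b = sA (msign (d * e)) (b * a)"

locale lie_superalgebra = super_vector_space sL L
  for sL :: "'k::field \<Rightarrow> 'l::ab_group_add \<Rightarrow> 'l" and L :: "bit \<Rightarrow> 'l set" +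
  fixes br :: "'l \<Rightarrow> 'l \<Rightarrow> 'l"
  assumes br_linear_left: "Vector_Spaces.linear sL sL (\<lambda>x. br x y)"
    and br_linear_right: "Vector_Spaces.linear sL sL (\<lambda>y. br x y)"
    and br_hom: "x \<in> L d \<Longrightarrow> y \<in> L e \<Longrightarrow> br x y \<in> L (d + e)"
    and br_skew: "x \<in> L d \<Longrightarrow> y \<in> L e \<Longrightarrow> br x y = - sL (msign (d * e)) (br y x)"
    and br_jacobi: "x \<in> L d \<Longrightarrow> y \<in> L e \<Longrightarrow> z \<in> L e' \<Longrightarrow>
      br x (br y z) = br (br x y) z + sL (msign (d * e)) (br y (br x z))"

locale lie_rinehart_superalgebra =
  fixes R :: "('k::field, 'a::ring, 'l::ab_group_add) lr_data"
  assumes A_superalgebra: "supercommutative_superalgebra (scaleA R) (homA R)"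
    and L_superalgebra: "lie_superalgebra (scaleL R) (homL R) (brak R)"
    and act_linear_left: "Vector_Spaces.linear (scaleA R) (scaleL R) (\<lambda>a. act R a x)"
    and act_linear_right: "Vector_Spaces.linear (scaleL R) (scaleL R) (\<lambda>x. act R a x)"
    and act_mult: "act R (a * b) x = act R a (act R b x)"
    and act_hom: "a \<in> homA R d \<Longrightarrow> x \<in> homL R e \<Longrightarrow> act R a x \<in> homL R (d + e)"
    and anchor_linear: "Vector_Spaces.linear (scaleL R) (scaleA R) (\<lambda>x. anchor R x a)"
    and anchor_hom: "x \<in> homL R d \<Longrightarrow> anchor R x \<in> superder_hom (scaleA R) (homA R) d"
    and anchor_brak: "x \<in> homL R d \<Longrightarrow> y \<in> homL R e \<Longrightarrow>
      anchor R (brak R x y) a =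
        anchor R x (anchor R y a) - scaleA R (msign (d * e)) (anchor R y (anchor R x a))"
    and leibniz: "x \<in> homL R d \<Longrightarrow> a \<in> homA R e \<Longrightarrow>
      brak R x (act R a y) =
        act R (anchor R x a) y + scaleL R (msign (e * d)) (act R a (brak R x y))"
    and anchor_act: "anchor R (act R a x) b = a * anchor R x b"

type_synonym 'l cochain = "'l list \<Rightarrow> 'l"

definition is_symbol ::
    "('k::field, 'a::ring, 'l::ab_group_add) lr_data \<Rightarrow> nat \<Rightarrow> bit \<Rightarrow> 'l cochain
      \<Rightarrow> ('l list \<Rightarrow> 'a \<Rightarrow> 'a) \<Rightarrow> bool"
  where "is_symbol R n j f \<sigma> \<longleftrightarrow>
    (\<forall>a. multilinear (scaleL R) (scaleA R) n (\<lambda>xs. \<sigma> xs a)) \<and>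
    (\<forall>xs. length xs = n \<longrightarrow> \<sigma> xs \<in> superder (scaleA R) (homA R)) \<and>
    (\<forall>ds xs x e. \<forall>a \<in> homA R e. length xs = n \<and> homogeneous (homL R) ds xs \<longrightarrow>
      f (xs @ [act R a x]) =
        scaleL R (msign (e * (j + sum_list ds))) (act R a (f (xs @ [x]))) + act R (\<sigma> xs a) x)"

definition Der_hom ::
    "('k::field, 'a::ring, 'l::ab_group_add) lr_data \<Rightarrow> nat \<Rightarrow> bit \<Rightarrow> 'l cochain set"
  where "Der_hom R n j = {f. multilinear (scaleL R) (scaleL R) (Suc n) f \<and>
    (\<forall>ds xs. length xs = Suc n \<and> homogeneous (homL R) ds xs \<longrightarrow>
      f xs \<in> homL R (j + sum_list ds)) \<and>
    (\<forall>ds xs i. length xs = Suc n \<and> homogeneous (homL R) ds xs \<and> i < n \<longrightarrow>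
      f xs = - scaleL R (msign (ds ! i * ds ! Suc i))
        (f (xs[i := xs ! Suc i, Suc i := xs ! i]))) \<and>
    (\<exists>\<sigma>. is_symbol R n j f \<sigma>)}"

definition Der ::
    "('k::field, 'a::ring, 'l::ab_group_add) lr_data \<Rightarrow> nat \<Rightarrow> 'l cochain set"
  where "Der R n = {\<lambda>xs. f0 xs + f1 xs | f0 f1. f0 \<in> Der_hom R n 0 \<and> f1 \<in> Der_hom R n 1}"

text \<open>
  Permutations act on the positions \<open>0, \<dots>, p + q\<close>, counted from \<open>0\<close> as usual for lists. The
  Koszul sign collects \<open>(-1)^(|x||y|)\<close> for each pair \<open>x\<close>, \<open>y\<close> whose order is reversed.
\<close>

definition koszul_sign :: "nat \<Rightarrow> (nat \<Rightarrow> nat) \<Rightarrow> bit list \<Rightarrow> 'k::field"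
  where "koszul_sign n \<tau> ds =
    (\<Prod>(i, j) | i < j \<and> j < n \<and> \<tau> j < \<tau> i. msign (ds ! \<tau> i * ds ! \<tau> j))"

definition shuffles_pq :: "nat \<Rightarrow> nat \<Rightarrow> (nat \<Rightarrow> nat) set"
  where "shuffles_pq p q = {\<tau>. \<tau> permutes {..<p + q + 1} \<and>
    strict_mono_on {..<q + 1} \<tau> \<and> strict_mono_on {q + 1..<p + q + 1} \<tau>}"

definition circ ::
    "('k::field, 'a, 'l::ab_group_add) lr_data \<Rightarrow> nat \<Rightarrow> nat
      \<Rightarrow> 'l cochain \<Rightarrow> 'l cochain \<Rightarrow> 'l cochain"
  where "circ R p q f g = hom_extend (homL R) (p + q + 1) (\<lambda>ds ys.
    \<Sum>\<tau>\<in>shuffles_pq p q.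
      scaleL R (of_int (sign \<tau>) * koszul_sign (p + q + 1) \<tau> ds)
        (f (g (map (\<lambda>i. ys ! \<tau> i) [0..<q + 1])
            # map (\<lambda>i. ys ! \<tau> i) [q + 1..<p + q + 1])))"

definition cbracket ::
    "('k::field, 'a, 'l::ab_group_add) lr_data \<Rightarrow> nat \<Rightarrow> nat
      \<Rightarrow> 'l cochain \<Rightarrow> 'l cochain \<Rightarrow> 'l cochain"
  where "cbracket R p q f g =
    (\<lambda>xs. circ R p q f g xs - scaleL R ((- 1) ^ (p * q)) (circ R q p g f xs))"

definition brak_cochain :: "('k, 'a, 'l::ab_group_add) lr_data \<Rightarrow> 'l cochain"
  where "brak_cochain R xs = (if length xs = 2 then brak R (xs ! 0) (xs ! 1) else 0)"

text \<open>The complex starts in degree \<open>1\<close>: \<open>def_complex R n\<close> is used for \<open>n \<ge> 1\<close>.\<close>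

definition def_complex ::
    "('k::field, 'a::ring, 'l::ab_group_add) lr_data \<Rightarrow> nat \<Rightarrow> 'l cochain set"
  where "def_complex R n = Der R (n - 1)"

definition cobd ::
    "('k::field, 'a, 'l::ab_group_add) lr_data \<Rightarrow> nat \<Rightarrow> 'l cochain \<Rightarrow> 'l cochain"
  where "cobd R n D = cbracket R 1 (n - 1) (brak_cochain R) D"

definition coboundaries ::
    "('k::field, 'a::ring, 'l::ab_group_add) lr_data \<Rightarrow> nat \<Rightarrow> 'l cochain set"
  where "coboundaries R n = cobd R (n - 1) ` def_complex R (n - 1)"

text \<open>
  A polynomial of degree at most \<open>M\<close> in \<open>t\<close> is given by its sequence of coefficients, of
  which only those with index at most \<open>M\<close> are relevant.
\<close>

definition deformation ::
    "('k::field, 'a::ring, 'l::ab_group_add) lr_data \<Rightarrow> nat \<Rightarrow> (nat \<Rightarrow> 'l cochain) \<Rightarrow> bool"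
  where "deformation R M mm \<longleftrightarrow> M \<ge> 1 \<and> mm 0 = brak_cochain R \<and>
    (\<forall>k\<le>M. mm k \<in> Der_hom R 1 0) \<and>
    (\<forall>k\<le>M. \<forall>xs. (\<Sum>(i, j) | i + j = k. cbracket R 1 1 (mm i) (mm j) xs) = 0)"

definition extends ::
    "('k::field, 'a::ring, 'l::ab_group_add) lr_data \<Rightarrow> nat \<Rightarrow> (nat \<Rightarrow> 'l cochain) \<Rightarrow> bool"
  where "extends R N mm \<longleftrightarrow> (\<exists>m' \<in> Der R 1. deformation R (Suc N) (mm(Suc N := m')))"

definition obstruction ::
    "('k::field, 'a, 'l::ab_group_add) lr_data \<Rightarrow> nat \<Rightarrow> (nat \<Rightarrow> 'l cochain) \<Rightarrow> 'l cochain"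
  where "obstruction R N mm = hom_extend (homL R) 3 (\<lambda>ds ys.
    let a = ys ! 0; b = ys ! 1; c = ys ! 2 in
    \<Sum>(i, j) | i + j = N + 1 \<and> 0 < i \<and> 0 < j.
      mm i [a, mm j [b, c]] - mm i [mm j [a, b], c]
        - scaleL R (msign (ds ! 0 * ds ! 1)) (mm i [b, mm j [a, c]]))"

end

theory Submission
  imports Defs
begin

text \<open>
  For even skew-symmetric \<open>f\<close> and \<open>g\<close> of two arguments, moving the inner value of \<open>f \<circ> g\<close> into
  the second slot of \<open>f\<close> turns \<open>f \<circ> g\<close> into minus the summand of the obstruction cochain.
  Hence the coefficient of \<open>t^(N+1)\<close> in \<open>[m\<^sub>t, m\<^sub>t]\<close> is twice \<open>\<delta> m\<^sub>N\<^sub>+\<^sub>1 - \<theta>\<^sub>N\<close>. As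
  \<open>\<theta>\<^sub>N\<close> is even and \<open>\<delta>\<close> preserves parity, the odd part of a cochain bounding \<open>\<theta>\<^sub>N\<close>
  can be dropped.
\<close>

section \<open>Signs, homogeneous components and multilinear extension\<close>

lemma msign_simps [simp]: "msign 0 = 1" "msign 1 = - 1"
  by (simp_all add: msign_def)

lemma msign_square [simp]: "msign d * msign d = 1"
  by (simp add: msign_def)

lemma msign_add: "msign (d + e) = msign d * msign e"
  by (cases d; cases e; simp)

lemma length_3_conv: "length xs = 3 \<longleftrightarrow> (\<exists>a b c. xs = [a, b, c])"
  by (auto simp: numeral_3_eq_3 length_Suc_conv)

context super_vector_space
begin

lemma zero_hom [simp]: "0 \<in> V d"
  using subspace_hom subspace_0 by blast

lemma hom_Int_eq: "u \<in> V d \<Longrightarrow> u \<in> V (d + 1) \<Longrightarrow> u = 0"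
  using hom_Int by (cases d) auto

text \<open>Two decompositions of the same vector differ by an element of both \<open>V d\<close>
  and \<open>V (d + 1)\<close>, hence by 0. So the description in \<open>hcomp\<close> has a unique
  solution.\<close>

lemma hcomp_eqI:
  assumes "u \<in> V d" "w \<in> V (d + 1)"
  shows "hcomp V d (u + w) = u"
  unfolding hcomp_def
proof (rule the_equality)
  show "u \<in> V d \<and> (\<exists>w'\<in>V (d + 1). u + w = u + w')"
    using assms by blast
next
  fix u' assume u': "u' \<in> V d \<and> (\<exists>w'\<in>V (d + 1). u + w = u' + w')"
  then obtain w' where w': "w' \<in> V (d + 1)" "u + w = u' + w'" by blast
  have eq: "u - u' = w' - w" using w'(2) by (simp add: algebra_simps)
  have "u - u' \<in> V d" using u' assms subspace_diff subspace_hom by blast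
  moreover have "u - u' \<in> V (d + 1)"
    unfolding eq using w' assms subspace_diff subspace_hom by blast
  ultimately show "u' = u" using hom_Int_eq by force
qed

lemma hom_decomp_eq: "\<exists>u\<in>V d. \<exists>w\<in>V (d + 1). v = u + w"
proof (cases d)
  case zero
  then show ?thesis using hom_decomp by simp
next
  case one
  obtain u w where "u \<in> V 0" "w \<in> V 1" "v = w + u"
    using hom_decomp[of v] add.commute by blast
  then show ?thesis using one by auto
qed

lemma hcomp_hom: "hcomp V d v \<in> V d"
  using hom_decomp_eq[of d v] hcomp_eqI by auto

lemma hcomp_same: "v \<in> V d \<Longrightarrow> hcomp V d v = v"
  using hcomp_eqI[of v d 0] by simp

lemma hcomp_other: "v \<in> V e \<Longrightarrow> e \<noteq> d \<Longrightarrow> hcomp V d v = 0"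
  using hcomp_eqI[of 0 d v] by (cases d; cases e) auto

lemma homogeneous_hcomp:
  "length ds = length xs \<Longrightarrow> homogeneous V ds (map2 (hcomp V) ds xs)"
  by (simp add: homogeneous_def list_all2_conv_all_nth hcomp_hom)

text \<open>\<open>hom_extend\<close> evaluates its formula only at lists of homogeneous components,
  so identities of multilinear maps may be checked on homogeneous arguments.\<close>

lemma hom_extend_cong:
  assumes "\<And>ds ys. length ys = n \<Longrightarrow> homogeneous V ds ys \<Longrightarrow> F ds ys = G ds ys"
  shows "hom_extend V n F = hom_extend V n G"
  by (auto simp: hom_extend_def fun_eq_iff intro!: sum.cong assms homogeneous_hcomp)

text \<open>If \<open>es\<close> differs from \<open>ds\<close> at some position, the component of
  degree \<open>es ! i\<close> there is 0, so the summand for \<open>es\<close> has a zero argument.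
  Vanishing on such lists is all that is asked of \<open>F\<close>, in place of full
  multilinearity.\<close>

lemma hom_extend_homogeneous:
  assumes F0: "\<And>es ys. length es = n \<Longrightarrow> length ys = n \<Longrightarrow> 0 \<in> set ys \<Longrightarrow> F es ys = 0"
    and xs: "length xs = n" "homogeneous V ds xs"
  shows "hom_extend V n F xs = F ds xs"
proof -
  have len: "length ds = n" and nth: "\<And>i. i < n \<Longrightarrow> xs ! i \<in> V (ds ! i)"
    using xs by (auto simp: homogeneous_def list_all2_conv_all_nth)
  have fin: "finite {es :: bit list. length es = n}"
  proof -
    have "set es \<subseteq> {0, 1}" for es :: "bit list"
      by (metis bit_not_zero_iff insertCI subsetI)
    then show ?thesis using finite_lists_length_eq[of "{0, 1 :: bit}" n] by simp
  qed
  have same: "map2 (hcomp V) ds xs = xs"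
    using len xs nth by (auto intro!: nth_equalityI simp: hcomp_same)
  have "F es (map2 (hcomp V) es xs) = 0" if es: "length es = n" "es \<noteq> ds" for es
  proof -
    obtain i where i: "i < n" "es ! i \<noteq> ds ! i"
      using es len nth_equalityI[of es ds] by auto
    have "map2 (hcomp V) es xs ! i = 0"
      using i es xs hcomp_other[OF nth[OF i(1)], of "es ! i"] by auto
    moreover have "i < length (map2 (hcomp V) es xs)"
      using i es xs by simp
    ultimately have "0 \<in> set (map2 (hcomp V) es xs)"
      by (metis nth_mem)
    then show ?thesis using es xs by (intro F0) auto
  qed
  then have "(\<Sum>es | length es = n. F es (map2 (hcomp V) es xs)) =
      (\<Sum>es\<in>{ds}. F es (map2 (hcomp V) es xs))"
    using fin len by (intro sum.mono_neutral_right) auto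
  then show ?thesis by (simp add: hom_extend_def xs same)
qed

end

lemma hom_extend_add:
  "hom_extend V n (\<lambda>ds ys. F ds ys + G ds ys) xs = hom_extend V n F xs + hom_extend V n G xs"
  by (simp add: hom_extend_def sum.distrib)

lemma hom_extend_uminus:
  "hom_extend V n (\<lambda>ds ys. - F ds ys) xs = - hom_extend V n F xs"
  by (simp add: hom_extend_def sum_negf)

lemma hom_extend_sum:
  "hom_extend V n (\<lambda>ds ys. \<Sum>i\<in>I. F i ds ys) xs = (\<Sum>i\<in>I. hom_extend V n (F i) xs)"
  by (simp add: hom_extend_def sum.swap[of _ I])

section \<open>The composition of two cochains of two arguments\<close>

lemma mem_shuffles_1_1_iff: "\<tau> \<in> shuffles_pq 1 1 \<longleftrightarrow> \<tau> permutes {..<3} \<and> \<tau> 0 < \<tau> 1"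
proof -
  \<comment> \<open>The second block is the single position 2, so monotonicity constrains only the
    positions 0 and 1.\<close>
  have "{..<1 + 1} = {0, 1 :: nat}" "{1 + 1..<3} = {2 :: nat}" "1 + 1 + 1 = (3 :: nat)"
    by auto
  then show ?thesis
    unfolding shuffles_pq_def strict_mono_on_def by (auto simp del: One_nat_def)
qed

text \<open>The value at 2 determines such a shuffle, because the two remaining values must appear
  in increasing order. The three elements have value 2, 1 and 0 there.\<close>

lemma shuffles_1_1:
  "shuffles_pq 1 1 =
    {id, transpose (1::nat) 2, transpose (0::nat) 1 \<circ> transpose 1 2}"
proof (intro equalityI subsetI)
  fix \<tau> assume "\<tau> \<in> shuffles_pq 1 1"
  then have p: "\<tau> permutes {..<3}" and lt: "\<tau> 0 < \<tau> 1"
    by (simp_all only: mem_shuffles_1_1_iff)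
  have "\<tau> i < 3" if "i < 3" for i using permutes_in_image[OF p, of i] that by simp
  then have b: "\<tau> 0 < 3" "\<tau> 1 < 3" "\<tau> 2 < 3" by auto
  have "inj \<tau>" using p permutes_inj by blast
  then have d: "\<tau> 0 \<noteq> \<tau> 2" "\<tau> 1 \<noteq> \<tau> 2" by (simp_all add: inj_eq)
  have out: "\<tau> i = i" if "\<not> i < 3" for i using p that by (auto simp: permutes_def)
  have cases: "i = 0 \<or> i = 1 \<or> i = 2 \<or> \<not> i < 3" for i :: nat by linarith
  consider "\<tau> 0 = 0" "\<tau> 1 = 1" "\<tau> 2 = 2" | "\<tau> 0 = 0" "\<tau> 1 = 2" "\<tau> 2 = 1"
    | "\<tau> 0 = 1" "\<tau> 1 = 2" "\<tau> 2 = 0"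
    using lt d cases[of "\<tau> 0"] cases[of "\<tau> 1"] cases[of "\<tau> 2"] b
    by (elim disjE) simp_all
  then show "\<tau> \<in> {id, transpose (1::nat) 2, transpose (0::nat) 1 \<circ> transpose 1 2}"
  proof cases
    case 1
    then have "\<tau> i = id i" for i using cases[of i] out[of i] by auto
    then have "\<tau> = id" by (rule ext)
    then show ?thesis by simp
  next
    case 2
    then have "\<tau> i = transpose 1 2 i" for i
      using cases[of i] out[of i] by (auto simp: transpose_def)
    then have "\<tau> = transpose 1 2" by (rule ext)
    then show ?thesis by simp
  next
    case 3
    then have "\<tau> i = (transpose 0 1 \<circ> transpose 1 2) i" for i
      using cases[of i] out[of i] by (auto simp: transpose_def)
    then have "\<tau> = transpose 0 1 \<circ> transpose 1 2" by (rule ext)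
    then show ?thesis by simp
  qed
next
  fix \<tau> assume "\<tau> \<in> {id, transpose (1::nat) 2, transpose (0::nat) 1 \<circ> transpose 1 2}"
  moreover have "transpose (1::nat) 2 permutes {..<3}" "transpose (0::nat) 1 permutes {..<3}"
    by (auto intro!: permutes_swap_id)
  ultimately show "\<tau> \<in> shuffles_pq 1 1"
    unfolding mem_shuffles_1_1_iff
    by (elim insertE emptyE) (simp_all add: transpose_def permutes_compose permutes_id del: One_nat_def)
qed

text \<open>One term for each choice of the argument left outside \<open>g\<close>. The coefficients
  are the signs 1, -1, 1 of the three shuffles times their Koszul signs.\<close>

definition circ2 ::
    "('k::field \<Rightarrow> 'l::ab_group_add \<Rightarrow> 'l) \<Rightarrow> 'l cochain \<Rightarrow> 'l cochain \<Rightarrow> bit list \<Rightarrow> 'l list \<Rightarrow> 'l"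
  where "circ2 s f g ds ys =
    f [g [ys ! 0, ys ! 1], ys ! 2]
    + s (- msign (ds ! 1 * ds ! 2)) (f [g [ys ! 0, ys ! 2], ys ! 1])
    + s (msign (ds ! 0 * (ds ! 1 + ds ! 2))) (f [g [ys ! 1, ys ! 2], ys ! 0])"

lemma circ_1_1:
  fixes R :: "('k::field, 'a::ring, 'l::ab_group_add) lr_data"
  assumes "vector_space (scaleL R)"
  shows "circ R 1 1 f g = hom_extend (homL R) 3 (circ2 (scaleL R) f g)"
proof -
  interpret vector_space "scaleL R" by fact
  let ?t = "transpose (1::nat) 2" and ?c = "transpose (0::nat) 1 \<circ> transpose 1 2"
  have t: "?t 0 = 0" "?t 1 = 2" "?t 2 = 1" by (auto simp: transpose_def)
  have c: "?c 0 = 1" "?c 1 = 2" "?c 2 = 0" by (auto simp: transpose_def)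
  have neq: "id \<noteq> ?t" "id \<noteq> ?c" "?t \<noteq> ?c"
    using t c by (metis id_apply zero_neq_one one_neq_zero)+
  have sgn: "sign ?t = - 1" "sign ?c = 1"
    by (auto simp: sign_compose sign_swap_id permutation_swap_id)
  have lt3: "i < j \<and> j < 3 \<longleftrightarrow> (i = 0 \<and> j = 1) \<or> (i = 0 \<and> j = 2) \<or> (i = 1 \<and> j = 2)"
    for i j :: nat by linarith
  \<comment> \<open>The Koszul sign is a product over inversions, so these sets give its
    factors.\<close>
  have inv: "{(i, j). i < j \<and> j < 3 \<and> id j < id i} = ({} :: (nat \<times> nat) set)"
    "{(i, j). i < j \<and> j < 3 \<and> ?t j < ?t i} = {(1, 2)}"
    "{(i, j). i < j \<and> j < 3 \<and> ?c j < ?c i} = {(0, 2), (1, 2)}"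
    unfolding conj_assoc[symmetric] lt3 by (auto simp del: comp_apply One_nat_def simp: t c)
  have kos: "koszul_sign 3 id ds = (1 :: 'k)"
    "koszul_sign 3 ?t ds = (msign (ds ! 1 * ds ! 2) :: 'k)"
    "koszul_sign 3 ?c ds = (msign (ds ! 0 * (ds ! 1 + ds ! 2)) :: 'k)" for ds
    unfolding koszul_sign_def inv distrib_left msign_add
    by (simp_all only: prod.empty prod.insert finite.intros insert_iff empty_iff prod.inject
        zero_neq_one simp_thms prod.case t c mult_1_left mult_1_right mult.commute)
  have upt: "[0..<1 + 1] = [0, 1 :: nat]" "[1 + 1..<3] = [2 :: nat]" "1 + 1 + 1 = (3 :: nat)"
    by (simp_all add: eval_nat_numeral)
  have "(\<Sum>\<tau>\<in>shuffles_pq 1 1.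
      scaleL R (of_int (sign \<tau>) * koszul_sign 3 \<tau> ds)
        (f (g (map (\<lambda>i. ys ! \<tau> i) [0, 1]) # map (\<lambda>i. ys ! \<tau> i) [2])))
      = circ2 (scaleL R) f g ds ys" for ds ys
    unfolding shuffles_1_1 circ2_def using neq by (simp only: sgn kos t c id_apply sum.insert finite.intros
        insert_iff empty_iff sum.empty list.map sign_id of_int_1 of_int_minus mult_1_left
        mult_minus_left scale_one simp_thms add_0_right add.assoc)
  then show ?thesis unfolding circ_def upt by (simp only:)
qed

section \<open>Basic properties of homogeneous cochains of two arguments\<close>

lemma linear_map_zero: "Vector_Spaces.linear s1 s2 h \<Longrightarrow> h 0 = 0"
proof -
  assume "Vector_Spaces.linear s1 s2 h"
  then interpret Vector_Spaces.linear s1 s2 h .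
  show ?thesis by (rule zero)
qed

lemma linear_map_add: "Vector_Spaces.linear s1 s2 h \<Longrightarrow> h (x + y) = h x + h y"
proof -
  assume "Vector_Spaces.linear s1 s2 h"
  then interpret Vector_Spaces.linear s1 s2 h .
  show ?thesis by (rule add)
qed

lemma
  assumes f: "f \<in> Der_hom R 1 j"
  shows Der_hom_1_zero: "f [0, y] = 0" "f [x, 0] = 0"
    and Der_hom_1_add: "f [x + x', y] = f [x, y] + f [x', y]"
    and Der_hom_1_hom: "x \<in> homL R d \<Longrightarrow> y \<in> homL R e \<Longrightarrow> f [x, y] \<in> homL R (j + d + e)"
    and Der_hom_1_skew: "x \<in> homL R d \<Longrightarrow> y \<in> homL R e \<Longrightarrow>
      f [x, y] = - scaleL R (msign (d * e)) (f [y, x])"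
proof -
  have m: "multilinear (scaleL R) (scaleL R) (Suc 1) f" using f by (simp add: Der_hom_def)
  then have lin: "Vector_Spaces.linear (scaleL R) (scaleL R) (\<lambda>z. f (xs[i := z]))"
    if "length xs = 2" "i < 2" for xs i using that by (auto simp: multilinear_def)
  \<comment> \<open>The varying slot is overwritten by the list update, so its entry in
    \<open>[y, y]\<close> is only a placeholder.\<close>
  have 1: "Vector_Spaces.linear (scaleL R) (scaleL R) (\<lambda>x. f [x, y])" using lin[of "[y, y]" 0] by simp
  have 2: "Vector_Spaces.linear (scaleL R) (scaleL R) (\<lambda>y. f [x, y])" using lin[of "[x, x]" 1] by simp
  show "f [0, y] = 0" "f [x, 0] = 0" using linear_map_zero[OF 1] linear_map_zero[OF 2] .
  show "f [x + x', y] = f [x, y] + f [x', y]" using linear_map_add[OF 1] .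
  assume xy: "x \<in> homL R d" "y \<in> homL R e"
  then have h: "length [x, y] = Suc 1" "homogeneous (homL R) [d, e] [x, y]"
    by (simp_all add: homogeneous_def)
  have "f [x, y] \<in> homL R (j + sum_list [d, e])"
    using f h unfolding Der_hom_def by blast
  then show "f [x, y] \<in> homL R (j + d + e)"
    by (simp only: sum_list.Cons sum_list.Nil add_0_right add.assoc)
  have "f [x, y] = - scaleL R (msign ([d, e] ! 0 * [d, e] ! Suc 0))
      (f ([x, y][0 := [x, y] ! Suc 0, Suc 0 := [x, y] ! 0]))"
    using f h unfolding Der_hom_def by blast
  then show "f [x, y] = - scaleL R (msign (d * e)) (f [y, x])" by simp
qed

section \<open>The obstruction cochain as a coefficient of the bracket\<close>

context lie_rinehart_superalgebra
begin

sublocale A: supercommutative_superalgebra "scaleA R" "homA R"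
  by (rule A_superalgebra)

sublocale L: lie_superalgebra "scaleL R" "homL R" "brak R"
  by (rule L_superalgebra)

text \<open>Each term feeds every argument into a slot of \<open>f\<close> or \<open>g\<close>, and
  both vanish when an argument is 0. This is the condition under which
  \<open>hom_extend_homogeneous\<close> evaluates \<open>circ\<close>.\<close>

lemma circ2_zero:
  assumes "f \<in> Der_hom R 1 j" "g \<in> Der_hom R 1 j'" "length ys = 3" "0 \<in> set ys"
  shows "circ2 (scaleL R) f g ds ys = 0"
proof -
  note [simp] = Der_hom_1_zero[OF assms(1)] Der_hom_1_zero[OF assms(2)]
  show ?thesis using assms(3,4) by (auto simp: length_3_conv circ2_def)
qed

lemma circ2_hom:
  assumes f: "f \<in> Der_hom R 1 j" and g: "g \<in> Der_hom R 1 j'"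
    and ys: "length ys = 3" "homogeneous (homL R) ds ys"
  shows "circ2 (scaleL R) f g ds ys \<in> homL R (j + j' + sum_list ds)"
proof -
  obtain a b c where [simp]: "ys = [a, b, c]" using ys by (auto simp: length_3_conv)
  obtain d e e' where [simp]: "ds = [d, e, e']"
    and h: "a \<in> homL R d" "b \<in> homL R e" "c \<in> homL R e'"
    using ys by (auto simp: homogeneous_def list_all2_Cons2)
  have "f [g [x, y], z] \<in> homL R (j + j' + (i + i' + i''))"
    if "x \<in> homL R i" "y \<in> homL R i'" "z \<in> homL R i''" for x y z i i' i''
    using Der_hom_1_hom[OF f Der_hom_1_hom[OF g that(1,2)] that(3)] by (simp only: add.assoc)
  moreover have "d + e' + e = sum_list ds" "e + e' + d = sum_list ds" "d + e + e' = sum_list ds"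
    by (simp_all only: \<open>ds = _\<close> sum_list.Cons sum_list.Nil add_0_right add_0_left add_ac)
  ultimately have "f [g [a, b], c] \<in> homL R (j + j' + sum_list ds)"
    "f [g [a, c], b] \<in> homL R (j + j' + sum_list ds)"
    "f [g [b, c], a] \<in> homL R (j + j' + sum_list ds)"
    using h by metis+
  then show ?thesis
    unfolding circ2_def \<open>ys = _\<close>
    by (intro L.subspace_add[OF L.subspace_hom] L.subspace_scale[OF L.subspace_hom]) simp_all
qed

text \<open>As \<open>g\<close> is even, \<open>g [x, y]\<close> has the sum of the degrees of
  \<open>x\<close> and \<open>y\<close>, which gives the sign for exchanging the two slots of
  \<open>f\<close>.\<close>

lemma circ2_eq_obstruction:
  assumes f: "f \<in> Der_hom R 1 0" and g: "g \<in> Der_hom R 1 0"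
    and h: "a \<in> homL R d" "b \<in> homL R e" "c \<in> homL R e'"
  shows "circ2 (scaleL R) f g [d, e, e'] [a, b, c] =
    - (f [a, g [b, c]] - f [g [a, b], c] - scaleL R (msign (d * e)) (f [b, g [a, c]]))"
proof -
  have 1: "f [g [a, c], b] = - scaleL R (msign ((d + e') * e)) (f [b, g [a, c]])"
    using Der_hom_1_skew[OF f Der_hom_1_hom[OF g h(1,3)] h(2)] by simp
  have 2: "f [g [b, c], a] = - scaleL R (msign ((e + e') * d)) (f [a, g [b, c]])"
    using Der_hom_1_skew[OF f Der_hom_1_hom[OF g h(2,3)] h(1)] by simp
  \<comment> \<open>Exchanging \<open>a\<close> with the inner value undoes its Koszul sign
    entirely. For \<open>b\<close>, the two contributions of the pair \<open>b\<close>,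
    \<open>c\<close> cancel and only the sign of the pair \<open>a\<close>, \<open>b\<close>
    remains.\<close>
  have sq: "msign (d * (e + e')) * msign ((e + e') * d) = (1 :: 'k)"
    unfolding mult.commute[of d "e + e'"] by (rule msign_square)
  have sg: "msign (e * e') * msign ((d + e') * e) = (msign (d * e) :: 'k)"
    by (cases d; cases e; cases e'; simp)
  show ?thesis
    by (simp add: circ2_def 1 2 sq sg L.scale_minus_right L.scale_minus_left)
qed

lemma circ_eq: "circ R 1 1 f g = hom_extend (homL R) 3 (circ2 (scaleL R) f g)"
  using circ_1_1 L.vector_space_axioms .

text \<open>For p = q = 1 the factor (-1)^(pq) is -1, so the bracket is a sum and symmetric.\<close>

lemma cbracket_1_1: "cbracket R 1 1 f g xs = circ R 1 1 f g xs + circ R 1 1 g f xs"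
  by (simp add: cbracket_def L.scale_minus_left)

lemma cobd_2: "cobd R 2 f xs = circ R 1 1 (brak_cochain R) f xs + circ R 1 1 f (brak_cochain R) xs"
  using cbracket_1_1 by (simp add: cobd_def)

lemma obstruction_eq:
  assumes mm: "\<forall>k\<le>N. mm k \<in> Der_hom R 1 0"
  shows "obstruction R N mm xs =
    - (\<Sum>(i, j) | i + j = N + 1 \<and> 0 < i \<and> 0 < j. circ R 1 1 (mm i) (mm j) xs)"
proof -
  let ?I = "{(i, j). i + j = N + 1 \<and> 0 < i \<and> 0 < j}"
  have "obstruction R N mm =
    hom_extend (homL R) 3 (\<lambda>ds ys. - (\<Sum>p\<in>?I. circ2 (scaleL R) (mm (fst p)) (mm (snd p)) ds ys))"
    unfolding obstruction_def
  proof (rule L.hom_extend_cong)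
    fix ds ys assume ys: "length ys = 3" "homogeneous (homL R) ds ys"
    obtain a b c where [simp]: "ys = [a, b, c]" using ys by (auto simp: length_3_conv)
    obtain d e e' where [simp]: "ds = [d, e, e']"
      and h: "a \<in> homL R d" "b \<in> homL R e" "c \<in> homL R e'"
      using ys by (auto simp: homogeneous_def list_all2_Cons2)
    show "(let a = ys ! 0; b = ys ! 1; c = ys ! 2 in
        \<Sum>(i, j)\<in>?I. mm i [a, mm j [b, c]] - mm i [mm j [a, b], c]
          - scaleL R (msign (ds ! 0 * ds ! 1)) (mm i [b, mm j [a, c]]))
      = - (\<Sum>p\<in>?I. circ2 (scaleL R) (mm (fst p)) (mm (snd p)) ds ys)"
      unfolding Let_def sum_negf[symmetric]
    proof (rule sum.cong)
      fix p assume "p \<in> ?I"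
      \<comment> \<open>Positive indices with sum N + 1 are both at most N, so only the given
        coefficients occur.\<close>
      then obtain i j where [simp]: "p = (i, j)" and "i \<le> N" "j \<le> N" by force
      then show "(case p of (i, j) \<Rightarrow> mm i [ys ! 0, mm j [ys ! 1, ys ! 2]] - mm i [mm j [ys ! 0, ys ! 1], ys ! 2]
          - scaleL R (msign (ds ! 0 * ds ! 1)) (mm i [ys ! 1, mm j [ys ! 0, ys ! 2]]))
        = - circ2 (scaleL R) (mm (fst p)) (mm (snd p)) ds ys"
        using circ2_eq_obstruction[OF mm[rule_format] mm[rule_format] h, of i j] by simp
    qed simp
  qed
  then show ?thesis
    by (simp del: One_nat_def add: hom_extend_uminus hom_extend_sum circ_eq case_prod_unfold)
qed

text \<open>The pairs (0, N+1) and (N+1, 0) contribute one differential of \<open>f\<close> each.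
  The other pairs involve only old coefficients and give twice the sum of compositions, that is,
  minus twice the obstruction.\<close>

lemma sum_cbracket_extension:
  assumes mm: "\<forall>k\<le>N. mm k \<in> Der_hom R 1 0" and m0: "mm 0 = brak_cochain R"
  shows "(\<Sum>(i, j) | i + j = Suc N.
      cbracket R 1 1 ((mm(Suc N := f)) i) ((mm(Suc N := f)) j) xs) =
    (cobd R 2 f xs - obstruction R N mm xs) + (cobd R 2 f xs - obstruction R N mm xs)"
proof -
  let ?I = "{(i, j). i + j = N + 1 \<and> 0 < i \<and> 0 < j}"
  let ?m = "mm(Suc N := f)"
  let ?S = "\<Sum>(i, j)\<in>?I. circ R 1 1 (mm i) (mm j) xs"
  have "?I \<subseteq> {..N + 1} \<times> {..N + 1}" by auto
  then have fin: "finite ?I" using finite_subset by blast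
  have split: "{(i, j). i + j = Suc N} = insert (0, Suc N) (insert (Suc N, 0) ?I)" by auto
  \<comment> \<open>The index set is symmetric, so both compositions in each bracket have the same
    total \<open>?S\<close>.\<close>
  have swap: "(\<Sum>(i, j)\<in>?I. circ R 1 1 (mm j) (mm i) xs) = ?S"
    by (rule sum.reindex_bij_witness[of _ prod.swap prod.swap]) auto
  have "(\<Sum>(i, j)\<in>?I. cbracket R 1 1 (?m i) (?m j) xs)
      = (\<Sum>(i, j)\<in>?I. circ R 1 1 (mm i) (mm j) xs + circ R 1 1 (mm j) (mm i) xs)"
    by (rule sum.cong) (auto simp: cbracket_1_1 simp del: One_nat_def)
  also have "\<dots> = ?S + ?S"
    using swap by (simp add: case_prod_unfold sum.distrib)
  finally have inner: "(\<Sum>(i, j)\<in>?I. cbracket R 1 1 (?m i) (?m j) xs) = ?S + ?S" .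
  have "(\<Sum>(i, j) | i + j = Suc N. cbracket R 1 1 (?m i) (?m j) xs) =
      cbracket R 1 1 (?m 0) (?m (Suc N)) xs + (cbracket R 1 1 (?m (Suc N)) (?m 0) xs + (?S + ?S))"
    unfolding split inner[symmetric] using fin by simp
  moreover have "cbracket R 1 1 (?m 0) (?m (Suc N)) xs = cobd R 2 f xs"
    "cbracket R 1 1 (?m (Suc N)) (?m 0) xs = cobd R 2 f xs"
    by (simp_all add: cbracket_1_1 cobd_2 m0 add.commute del: One_nat_def)
  ultimately show ?thesis
    unfolding obstruction_eq[OF mm] by (simp only: diff_minus_eq_add add_ac)
qed

section \<open>Parity and additivity of the differential\<close>

lemma cobd_2_eq_hom_extend:
  "cobd R 2 f xs = hom_extend (homL R) 3 (\<lambda>ds ys.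
    circ2 (scaleL R) (brak_cochain R) f ds ys + circ2 (scaleL R) f (brak_cochain R) ds ys) xs"
  by (simp add: cobd_2 circ_eq hom_extend_add del: One_nat_def)

text \<open>Composing with the even bracket on either side leaves the degree of \<open>f\<close>
  unchanged. Membership of the bracket in \<open>Der_hom R 1 0\<close> is supplied later by the
  coefficient \<open>mm 0\<close>.\<close>

lemma cobd_2_homogeneous:
  assumes m: "brak_cochain R \<in> Der_hom R 1 0" and f: "f \<in> Der_hom R 1 j"
    and xs: "length xs = 3" "homogeneous (homL R) ds xs"
  shows "cobd R 2 f xs \<in> homL R (j + sum_list ds)"
proof -
  have "cobd R 2 f xs =
      circ2 (scaleL R) (brak_cochain R) f ds xs + circ2 (scaleL R) f (brak_cochain R) ds xs"
    unfolding cobd_2_eq_hom_extend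
    using xs circ2_zero[OF m f] circ2_zero[OF f m] by (intro L.hom_extend_homogeneous) auto
  then show ?thesis
    using circ2_hom[OF m f xs] circ2_hom[OF f m xs] L.subspace_add[OF L.subspace_hom] by simp
qed

lemma obstruction_homogeneous:
  assumes mm: "\<forall>k\<le>N. mm k \<in> Der_hom R 1 0"
    and xs: "length xs = 3" "homogeneous (homL R) ds xs"
  shows "obstruction R N mm xs \<in> homL R (sum_list ds)"
proof -
  have "circ R 1 1 f g xs \<in> homL R (sum_list ds)"
    if "f \<in> Der_hom R 1 0" "g \<in> Der_hom R 1 0" for f g
  proof -
    have "circ R 1 1 f g xs = circ2 (scaleL R) f g ds xs"
      unfolding circ_eq using circ2_zero[OF that] xs by (intro L.hom_extend_homogeneous) auto
    then show ?thesis using circ2_hom[OF that xs] unfolding add_0_left by simp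
  qed
  then show ?thesis
    unfolding obstruction_eq[OF mm]
    by (intro L.subspace_neg[OF L.subspace_hom] L.subspace_sum[OF L.subspace_hom])
      (use mm in \<open>auto simp del: One_nat_def\<close>)
qed

text \<open>Where the cochain is outside, the sum splits pointwise; where it is inside, it splits by
  additivity of the bracket in its first slot.\<close>

lemma cobd_2_add:
  assumes m: "brak_cochain R \<in> Der_hom R 1 0"
  shows "cobd R 2 (\<lambda>xs. f xs + g xs) xs = cobd R 2 f xs + cobd R 2 g xs"
proof -
  have "brak_cochain R [x + y, z] = brak_cochain R [x, z] + brak_cochain R [y, z]" for x y z
    using Der_hom_1_add[OF m] .
  then have "(\<lambda>ds ys. circ2 (scaleL R) (brak_cochain R) (\<lambda>xs. f xs + g xs) ds ys
        + circ2 (scaleL R) (\<lambda>xs. f xs + g xs) (brak_cochain R) ds ys) =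
      (\<lambda>ds ys. (circ2 (scaleL R) (brak_cochain R) f ds ys + circ2 (scaleL R) f (brak_cochain R) ds ys)
        + (circ2 (scaleL R) (brak_cochain R) g ds ys + circ2 (scaleL R) g (brak_cochain R) ds ys))"
    by (simp add: fun_eq_iff circ2_def L.scale_right_distrib add_ac)
  then show ?thesis by (simp add: cobd_2_eq_hom_extend hom_extend_add)
qed

section \<open>Reduction to even bounding cochains\<close>

lemma zero_superder_hom: "(\<lambda>_. 0) \<in> superder_hom (scaleA R) (homA R) j"
  by (simp add: superder_hom_def A.vector_space_axioms vector_space_pair.intro
      vector_space_pair.linear_zero)

text \<open>The zero symbol serves. The zero cochain is the missing odd part when an even cochain is
  viewed as an element of \<open>Der\<close>.\<close>

lemma zero_Der_hom: "(\<lambda>_. 0) \<in> Der_hom R n j"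
proof -
  have "(\<lambda>_. 0) \<in> superder (scaleA R) (homA R)"
    unfolding superder_def
    by (intro CollectI exI[of _ "\<lambda>_. 0"]) (simp add: zero_superder_hom)
  moreover have "multilinear (scaleL R) (scaleA R) n (\<lambda>_. 0)"
    "multilinear (scaleL R) (scaleL R) (Suc n) (\<lambda>_. 0)"
    by (simp_all add: multilinear_def A.vector_space_axioms L.vector_space_axioms
      vector_space_pair.intro vector_space_pair.linear_zero)
  moreover have "act R 0 x = 0" "act R a 0 = 0" for a x
    using linear_map_zero[OF act_linear_left] linear_map_zero[OF act_linear_right] .
  ultimately have "is_symbol R n j (\<lambda>_. 0) (\<lambda>_ _. 0)"
    by (simp add: is_symbol_def)
  then show ?thesis
    using \<open>multilinear (scaleL R) (scaleL R) (Suc n) (\<lambda>_. 0)\<close> unfolding Der_hom_def by auto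
qed

lemma Der_hom_0_subset_Der: "Der_hom R n 0 \<subseteq> Der R n"
proof
  fix f assume "f \<in> Der_hom R n 0"
  then show "f \<in> Der R n"
    unfolding Der_def
    by (intro CollectI exI[of _ f] exI[of _ "\<lambda>_. 0"]) (simp add: zero_Der_hom)
qed

lemma obstruction_coboundary_iff:
  assumes mm: "\<forall>k\<le>N. mm k \<in> Der_hom R 1 0" and m0: "mm 0 = brak_cochain R"
  shows "obstruction R N mm \<in> coboundaries R 3 \<longleftrightarrow>
    (\<exists>f\<in>Der_hom R 1 0. cobd R 2 f = obstruction R N mm)"
proof
  assume "\<exists>f\<in>Der_hom R 1 0. cobd R 2 f = obstruction R N mm"
  then obtain f where "f \<in> Der R 1" "cobd R 2 f = obstruction R N mm"
    using Der_hom_0_subset_Der[of 1] by blast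
  then show "obstruction R N mm \<in> coboundaries R 3"
    by (force simp: coboundaries_def def_complex_def)
next
  assume "obstruction R N mm \<in> coboundaries R 3"
  then obtain \<phi> where \<phi>: "\<phi> \<in> Der R 1" "obstruction R N mm = cobd R 2 \<phi>"
    by (auto simp: coboundaries_def def_complex_def)
  then obtain f0 f1 where f: "f0 \<in> Der_hom R 1 0" "f1 \<in> Der_hom R 1 1"
    and "\<phi> = (\<lambda>xs. f0 xs + f1 xs)" unfolding Der_def by blast
  have m: "brak_cochain R \<in> Der_hom R 1 0" using mm m0 by auto
  have eq: "obstruction R N mm xs = cobd R 2 f0 xs + cobd R 2 f1 xs" for xs
    using \<phi> \<open>\<phi> = _\<close> cobd_2_add[OF m] by simp
  let ?F = "\<lambda>ds ys. circ2 (scaleL R) (brak_cochain R) f1 ds ys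
    + circ2 (scaleL R) f1 (brak_cochain R) ds ys"
  \<comment> \<open>On homogeneous arguments the differential of \<open>f1\<close> is odd, yet it
    equals the obstruction minus the differential of \<open>f0\<close>, which is even. Hence it
    vanishes.\<close>
  have odd: "?F ds ys = 0" if ys: "length ys = 3" "homogeneous (homL R) ds ys" for ds ys
  proof -
    have "cobd R 2 f1 ys = ?F ds ys"
      unfolding cobd_2_eq_hom_extend
      using ys circ2_zero[OF m f(2)] circ2_zero[OF f(2) m]
      by (intro L.hom_extend_homogeneous) auto
    moreover have "cobd R 2 f1 ys = 0"
    proof (rule L.hom_Int_eq)
      have "obstruction R N mm ys - cobd R 2 f0 ys \<in> homL R (sum_list ds)"
        by (intro L.subspace_diff[OF L.subspace_hom] obstruction_homogeneous[OF mm ys]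
          cobd_2_homogeneous[OF m f(1) ys, unfolded add_0_left])
      then show "cobd R 2 f1 ys \<in> homL R (sum_list ds)" using eq by simp
      show "cobd R 2 f1 ys \<in> homL R (sum_list ds + 1)"
        using cobd_2_homogeneous[OF m f(2) ys] by (simp add: add.commute)
    qed
    ultimately show ?thesis by simp
  qed
  \<comment> \<open>A formula that is zero on homogeneous arguments has zero multilinear extension,
    so the vanishing passes to arbitrary arguments.\<close>
  have vanish: "hom_extend (homL R) 3 ?F = hom_extend (homL R) 3 (\<lambda>_ _. 0)"
    using odd by (intro L.hom_extend_cong)
  have "cobd R 2 f1 xs = 0" for xs
    unfolding cobd_2_eq_hom_extend vanish by (simp add: hom_extend_def)
  then have "cobd R 2 f0 = obstruction R N mm" using eq by (simp add: fun_eq_iff)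
  then show "\<exists>f\<in>Der_hom R 1 0. cobd R 2 f = obstruction R N mm" using f by blast
qed

end

section \<open>The extension criterion\<close>

theorem theorem4p22:
  fixes R :: "('k::field_char_0, 'a::ring, 'l::ab_group_add) lr_data"
    and mm :: "nat \<Rightarrow> 'l list \<Rightarrow> 'l"
    and N :: nat
  assumes "lie_rinehart_superalgebra R"
    and "N \<ge> 1"
    and "deformation R N mm"
  shows "extends R N mm \<longleftrightarrow> obstruction R N mm \<in> coboundaries R 3"
proof -
  interpret lie_rinehart_superalgebra R by fact
  have mm: "\<forall>k\<le>N. mm k \<in> Der_hom R 1 0"
    and m0: "mm 0 = brak_cochain R"
    using assms(3) unfolding deformation_def by blast+
  have sum0: "(\<Sum>(i, j) | i + j = k. cbracket R 1 1 (mm i) (mm j) xs) = 0" if "k \<le> N" for k xs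
    using assms(3) that unfolding deformation_def by blast
  \<comment> \<open>Characteristic zero enters here: 2 is nonzero in the field, so the factor 2 in
    the new coefficient can be cancelled.\<close>
  have double: "x + x = 0 \<longleftrightarrow> x = 0" for x :: 'l
  proof -
    have "x + x = scaleL R 2 x"
      using L.scale_left_distrib[of 1 1 x] by simp
    then show ?thesis by simp
  qed
  have "deformation R (Suc N) (mm(Suc N := f)) \<longleftrightarrow>
      f \<in> Der_hom R 1 0 \<and> cobd R 2 f = obstruction R N mm" for f
  proof -
    let ?m = "mm(Suc N := f)"
    \<comment> \<open>Below order N + 1 the indices never reach \<open>Suc N\<close>, so
      \<open>f\<close> does not occur.\<close>
    have old: "(\<Sum>(i, j) | i + j = k. cbracket R 1 1 (?m i) (?m j) xs) = 0" if "k \<le> N" for k xs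
    proof -
      have "(\<Sum>(i, j) | i + j = k. cbracket R 1 1 (?m i) (?m j) xs) =
          (\<Sum>(i, j) | i + j = k. cbracket R 1 1 (mm i) (mm j) xs)"
        using that by (intro sum.cong) auto
      then show ?thesis using sum0[OF that] by simp
    qed
    have new: "(\<Sum>(i, j) | i + j = Suc N. cbracket R 1 1 (?m i) (?m j) xs) = 0 \<longleftrightarrow>
        cobd R 2 f xs = obstruction R N mm xs" for xs
      unfolding sum_cbracket_extension[OF mm m0] double by simp
    have "(\<forall>k\<le>Suc N. \<forall>xs. (\<Sum>(i, j) | i + j = k. cbracket R 1 1 (?m i) (?m j) xs) = 0) \<longleftrightarrow>
        cobd R 2 f = obstruction R N mm"
      unfolding fun_eq_iff new[symmetric] using old le_Suc_eq by blast
    moreover have "(\<forall>k\<le>Suc N. ?m k \<in> Der_hom R 1 0) \<longleftrightarrow> f \<in> Der_hom R 1 0"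
      using mm by (auto simp: le_Suc_eq)
    ultimately show ?thesis
      using m0 unfolding deformation_def by simp
  qed
  \<comment> \<open>\<open>extends\<close> lets the new coefficient range over all of
    \<open>Der R 1\<close>, but being a deformation already forces it to be even.\<close>
  then have "extends R N mm \<longleftrightarrow> (\<exists>f\<in>Der_hom R 1 0. cobd R 2 f = obstruction R N mm)"
    using Der_hom_0_subset_Der[of 1] unfolding extends_def by blast
  then show ?thesis
    using obstruction_coboundary_iff[OF mm m0] by simp
qed

end
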